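(* Let $(X_n,Y_n)=B_n(x,y)$ with $X_n,Y_n\in\mathbb{Z}[x,y]$ be the $n$th folding map for the Lie algebra $\mathcal{B}_2$. Then $$X_n=x^n-nx^{n-2}y-nx^{n-2}+\frac{n(n-3)}{2}x^{n-4}y^2+O(n-3),$$ $$Y_n=y^n-nx^2y^{n-2}+x^3\cdot O(n-3)+O(n-1).$$
   Context: The polynomials are given by $(X_0,Y_0)=(4,4)$, $(X_1,Y_1)=(x,y)$, $(X_2,Y_2)=(x^2-2y-4,\ y^2-2x^2+4y+4)$, $(X_3,Y_3)=(x^3-3xy-3x,\ y^3-3x^2y+6y^2+9y)$, and subsequently by the recursion $$X_{n+4}=x(X_{n+3}+X_{n+1})-(2+y)X_{n+2}-X_n,\qquad Y_{n+4}=y(Y_{n+3}+Y_{n+1})-(x^2-2y-2)Y_{n+2}-Y_n.$$ The notation $O(d)$ stands for some polynomial in $x,y$ of total degree at most $d$ (possibly different at each occurrence); thus $x^3\cdot O(n-3)$ is $x^3$ times a polynomial of total degree at most $n-3$.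
   Formalization: The formula for X_n is stated for n ≥ 3 and that for Y_n for n ≥ 2; for smaller n the formulas are false (X_0 = Y_0 = 4, not 1; X_2 has an x^{-2}y^2 term) or involve negative powers. *)

theory Defs
  imports "HOL-Computational_Algebra.Polynomial"
begin

text \<open>The ring \<open>\<int>[x,y]\<close> is rendered as \<open>\<int>[x][y]\<close>: the coefficient of \<open>x\<^sup>i y\<^sup>j\<close> in \<open>p\<close> is
  \<open>coeff (coeff p j) i\<close>.\<close>

type_synonym poly_xy = "int poly poly"

definition var_x :: poly_xy where "var_x = [:[:0, 1:]:]"

definition var_y :: poly_xy where "var_y = [:0, 1:]"

text \<open>The folding maps of \<open>\<B>\<^sub>2\<close> are specified by their values for \<open>n \<le> 3\<close> and order-four
  linear recurrences.\<close>

fun fold_X :: "nat \<Rightarrow> poly_xy" where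
  "fold_X 0 = 4"
| "fold_X (Suc 0) = var_x"
| "fold_X (Suc (Suc 0)) = var_x^2 - 2 * var_y - 4"
| "fold_X (Suc (Suc (Suc 0))) = var_x^3 - 3 * var_x * var_y - 3 * var_x"
| "fold_X (Suc (Suc (Suc (Suc n)))) =
     var_x * (fold_X (Suc (Suc (Suc n))) + fold_X (Suc n))
     - (2 + var_y) * fold_X (Suc (Suc n)) - fold_X n"

fun fold_Y :: "nat \<Rightarrow> poly_xy" where
  "fold_Y 0 = 4"
| "fold_Y (Suc 0) = var_y"
| "fold_Y (Suc (Suc 0)) = var_y^2 - 2 * var_x^2 + 4 * var_y + 4"
| "fold_Y (Suc (Suc (Suc 0))) = var_y^3 - 3 * var_x^2 * var_y + 6 * var_y^2 + 9 * var_y"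
| "fold_Y (Suc (Suc (Suc (Suc n)))) =
     var_y * (fold_Y (Suc (Suc (Suc n))) + fold_Y (Suc n))
     - (var_x^2 - 2 * var_y - 2) * fold_Y (Suc (Suc n)) - fold_Y n"

definition folding_map_B2 :: "nat \<Rightarrow> poly_xy \<times> poly_xy" where
  "folding_map_B2 n = (fold_X n, fold_Y n)"

text \<open>The polynomials of total degree at most \<open>d\<close>. The bound is an integer, and for \<open>d < 0\<close>
  only the zero polynomial qualifies.\<close>

definition total_degree_le :: "int \<Rightarrow> poly_xy set" where
  "total_degree_le d = {p. \<forall>i j. coeff (coeff p j) i \<noteq> 0 \<longrightarrow> int i + int j \<le> d}"

end

theory Submission
  imports Defs
begin

text \<open>In the recurrence for \<open>fold_X\<close>, only the term \<open>x X\<^sub>n\<^sub>+\<^sub>3\<close> needs the expansion to the order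
  at hand; the other three terms have lower degree and need it to a smaller order only. So the
  order is raised one step at a time, by an induction along the recurrence for each order in turn.
  For \<open>fold_Y\<close> one such induction is enough: the term \<open>- x\<^sup>2 Y\<^sub>n\<^sub>+\<^sub>2\<close> contributes \<open>- x\<^sup>2 y\<^sup>n\<^sup>+\<^sup>2\<close> and
  otherwise only multiples of \<open>x\<^sup>3\<close> and terms of low degree.\<close>

lemma total_degree_le_mono: "p \<in> total_degree_le a \<Longrightarrow> a \<le> b \<Longrightarrow> p \<in> total_degree_le b"
  unfolding total_degree_le_def by force

lemma total_degree_le_0: "0 \<in> total_degree_le d"
  by (simp add: total_degree_le_def)

lemma total_degree_le_add:
  assumes "p \<in> total_degree_le d" "q \<in> total_degree_le d"
  shows "p + q \<in> total_degree_le d"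
  unfolding total_degree_le_def
proof (intro CollectI allI impI)
  fix i j assume "coeff (coeff (p + q) j) i \<noteq> 0"
  then have "coeff (coeff p j) i \<noteq> 0 \<or> coeff (coeff q j) i \<noteq> 0" by auto
  then show "int i + int j \<le> d" using assms by (auto simp: total_degree_le_def)
qed

lemma total_degree_le_uminus: "p \<in> total_degree_le d \<Longrightarrow> - p \<in> total_degree_le d"
  by (simp add: total_degree_le_def)

lemma total_degree_le_diff:
  "p \<in> total_degree_le d \<Longrightarrow> q \<in> total_degree_le d \<Longrightarrow> p - q \<in> total_degree_le d"
  using total_degree_le_add[OF _ total_degree_le_uminus, of p d q] by simp

lemma total_degree_le_mult:
  assumes "p \<in> total_degree_le a" "q \<in> total_degree_le b"
  shows "p * q \<in> total_degree_le (a + b)"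
  unfolding total_degree_le_def
proof (intro CollectI allI impI)
  fix i j assume "coeff (coeff (p * q) j) i \<noteq> 0"
  moreover have "coeff (coeff (p * q) j) i =
      (\<Sum>k\<le>j. \<Sum>l\<le>i. coeff (coeff p k) l * coeff (coeff q (j - k)) (i - l))"
    by (simp add: coeff_mult coeff_sum)
  ultimately obtain k where "k \<le> j"
      "(\<Sum>l\<le>i. coeff (coeff p k) l * coeff (coeff q (j - k)) (i - l)) \<noteq> 0"
    by (metis (no_types, lifting) atMost_iff sum.neutral)
  moreover from this obtain l where "l \<le> i"
      "coeff (coeff p k) l * coeff (coeff q (j - k)) (i - l) \<noteq> 0"
    by (metis (no_types, lifting) atMost_iff sum.neutral)
  ultimately have "k \<le> j" "l \<le> i" "coeff (coeff p k) l \<noteq> 0" "coeff (coeff q (j - k)) (i - l) \<noteq> 0"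
    by auto
  moreover from this have "int l + int k \<le> a" "int (i - l) + int (j - k) \<le> b"
    using assms unfolding total_degree_le_def by blast+
  ultimately show "int i + int j \<le> a + b" by linarith
qed

lemma total_degree_le_of_int: "0 \<le> d \<Longrightarrow> of_int c \<in> total_degree_le d"
  by (auto simp: total_degree_le_def of_int_poly coeff_pCons split: nat.splits)

lemma total_degree_le_of_nat: "0 \<le> d \<Longrightarrow> of_nat c \<in> total_degree_le d"
  using total_degree_le_of_int[of d "int c"] by simp

lemma total_degree_le_numeral: "0 \<le> d \<Longrightarrow> numeral c \<in> total_degree_le d"
  using total_degree_le_of_int[of d "numeral c"] by simp

lemma total_degree_le_1: "0 \<le> d \<Longrightarrow> 1 \<in> total_degree_le d"
  using total_degree_le_of_int[of d 1] by simp

lemma total_degree_le_var_x: "1 \<le> d \<Longrightarrow> var_x \<in> total_degree_le d"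
  by (auto simp: total_degree_le_def var_x_def coeff_pCons split: nat.splits)

lemma total_degree_le_var_y: "1 \<le> d \<Longrightarrow> var_y \<in> total_degree_le d"
  by (auto simp: total_degree_le_def var_y_def coeff_pCons split: nat.splits)

lemma total_degree_le_power:
  assumes "p \<in> total_degree_le 1" "int k \<le> d"
  shows "p ^ k \<in> total_degree_le d"
proof -
  have "p ^ k \<in> total_degree_le (int k)"
  proof (induction k)
    case (Suc k)
    then show ?case using total_degree_le_mult[OF assms(1) Suc] by simp
  qed (simp add: total_degree_le_1)
  then show ?thesis using assms(2) by (rule total_degree_le_mono)
qed

text \<open>Form for backward reasoning: once the bound \<open>a\<close> of the left factor is
  fixed, any goal bound \<open>d\<close> matches and \<open>d - a\<close> is left for the right
  factor.\<close>

lemma total_degree_le_mult_left: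
  assumes "p \<in> total_degree_le a" "q \<in> total_degree_le (d - a)"
  shows "p * q \<in> total_degree_le d"
  using total_degree_le_mult[OF assms] by simp

text \<open>Every product rule fixes an atomic left factor (a constant, a variable or a power of
  one). Products therefore have to be nested to the right, which explains \<open>mult.assoc\<close>
  and the bracketing in later proofs.\<close>

lemmas total_degree_le_intros =
  total_degree_le_0 total_degree_le_1 total_degree_le_numeral
  total_degree_le_var_x total_degree_le_var_y
  total_degree_le_power[OF total_degree_le_var_x[OF order_refl]]
  total_degree_le_power[OF total_degree_le_var_y[OF order_refl]]
  total_degree_le_add total_degree_le_diff total_degree_le_uminus
  total_degree_le_mult_left[OF total_degree_le_of_nat[OF order_refl]]
  total_degree_le_mult_left[OF total_degree_le_numeral[OF order_refl]]
  total_degree_le_mult_left[OF total_degree_le_var_x[OF order_refl]]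
  total_degree_le_mult_left[OF total_degree_le_var_y[OF order_refl]]
  total_degree_le_mult_left[OF total_degree_le_power[OF total_degree_le_var_x[OF order_refl] order_refl]]
  total_degree_le_mult_left[OF total_degree_le_power[OF total_degree_le_var_y[OF order_refl] order_refl]]

lemma fold_X_degree: "fold_X n \<in> total_degree_le (int n)"
proof (induction n rule: fold_X.induct)
  case (5 n)
  show ?case
    unfolding fold_X.simps distrib_right
    by (intro total_degree_le_intros 5[THEN total_degree_le_mono]) simp_all
qed (simp_all add: mult.assoc power2_eq_square power3_eq_cube, (intro total_degree_le_intros; simp)+)

lemma fold_X_order_1:
  "n \<ge> 1 \<Longrightarrow> fold_X n - var_x ^ n \<in> total_degree_le (int n - 1)"
proof (induction n rule: fold_X.induct)
  case (5 n)
  have eq: "fold_X (Suc (Suc (Suc (Suc n)))) - var_x ^ Suc (Suc (Suc (Suc n))) =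
      var_x * (fold_X (Suc (Suc (Suc n))) - var_x ^ Suc (Suc (Suc n)))
      + var_x * fold_X (Suc n) - 2 * fold_X (Suc (Suc n))
      - var_y * fold_X (Suc (Suc n)) - fold_X n"
    by (simp add: algebra_simps)
  show ?case
    unfolding eq
    by (intro total_degree_le_intros 5(1)[THEN total_degree_le_mono]
        fold_X_degree[THEN total_degree_le_mono]) simp_all
qed (simp_all add: mult.assoc power2_eq_square power3_eq_cube, (intro total_degree_le_intros; simp)+)

lemma fold_X_order_2:
  "n \<ge> 2 \<Longrightarrow> fold_X n - (var_x ^ n - of_nat n * var_x ^ (n - 2) * var_y)
    \<in> total_degree_le (int n - 2)"
proof (induction n rule: fold_X.induct)
  case (5 n)
  \<comment> \<open>The leading term of y X_(n+2) is x^(n+2) y. Each step subtracts one more copy of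
    it, so the coefficient grows by 1 with the index.\<close>
  have eq: "fold_X (Suc (Suc (Suc (Suc n)))) - (var_x ^ Suc (Suc (Suc (Suc n)))
        - of_nat (Suc (Suc (Suc (Suc n)))) * var_x ^ (Suc (Suc (Suc (Suc n))) - 2) * var_y) =
      var_x * (fold_X (Suc (Suc (Suc n))) - (var_x ^ Suc (Suc (Suc n))
        - of_nat (Suc (Suc (Suc n))) * var_x ^ (Suc (Suc (Suc n)) - 2) * var_y))
      + var_x * fold_X (Suc n) - 2 * fold_X (Suc (Suc n))
      - var_y * (fold_X (Suc (Suc n)) - var_x ^ Suc (Suc n)) - fold_X n"
    by (simp add: algebra_simps)
  show ?case
    unfolding eq
    by (intro total_degree_le_intros 5(1)[THEN total_degree_le_mono]
        fold_X_order_1[THEN total_degree_le_mono]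
        fold_X_degree[THEN total_degree_le_mono]) simp_all
qed (simp_all add: mult.assoc power2_eq_square power3_eq_cube, (intro total_degree_le_intros; simp)+)

text \<open>Two contributions are new at this order. The leading terms of x X_(n+1) - 2 X_(n+2) sum
  to -x^(n+2), so the coefficient of x^(n-2) is again -n. The second term of -y X_(n+2) is (n+2) x^n
  y^2, so the last coefficient c satisfies c(n+4) = c(n+3) + n + 2, which m(m-3)/2 solves.\<close>

lemma fold_X_order_3:
  "n \<ge> 3 \<Longrightarrow> fold_X n - (var_x ^ n - of_nat n * var_x ^ (n - 2) * var_y
      - of_nat n * var_x ^ (n - 2)
      + of_int (int n * (int n - 3) div 2) * var_x ^ (n - 4) * var_y ^ 2)
    \<in> total_degree_le (int n - 3)" (is "_ \<Longrightarrow> fold_X n - ?M n \<in> _")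
proof (induction n rule: fold_X.induct)
  case (5 n)
  define c where "c = int (n + 3) * (int (n + 3) - 3) div 2"
  have c': "int (n + 4) * (int (n + 4) - 3) div 2 = c + int n + 2"
  proof -
    have "int (n + 4) * (int (n + 4) - 3) = int (n + 3) * (int (n + 3) - 3) + 2 * (int n + 2)"
      by (simp add: algebra_simps)
    \<comment> \<open>The numerators differ by an even number, which passes through
      \<open>div 2\<close> whatever the parity of the rest.\<close>
    then show ?thesis unfolding c_def by (metis add.assoc div_mult_self2 zero_neq_numeral add.commute)
  qed
  \<comment> \<open>For \<open>n = 0\<close> the exponent \<open>n - 1\<close> is truncated, but then \<open>c = 0\<close>.\<close>
  have c0: "var_x * (of_int c * (var_x ^ (n - 1) * var_y ^ 2)) = of_int c * (var_x ^ n * var_y ^ 2)"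
    by (cases n) (simp_all add: c_def algebra_simps)
  have M3: "var_x * ?M (Suc (Suc (Suc n))) = var_x ^ (n + 4)
      - of_nat (n + 3) * (var_x ^ (n + 2) * var_y) - of_nat (n + 3) * var_x ^ (n + 2)
      + of_int c * (var_x ^ n * var_y ^ 2)"
  proof -
    have "int (Suc (Suc (Suc n))) * (int (Suc (Suc (Suc n))) - 3) div 2 = c"
      by (simp add: c_def algebra_simps)
    then show ?thesis
      using c0 by (simp only:) (simp add: algebra_simps power_add eval_nat_numeral)
  qed
  have M4: "?M (Suc (Suc (Suc (Suc n)))) = var_x ^ (n + 4)
      - of_nat (n + 4) * (var_x ^ (n + 2) * var_y) - of_nat (n + 4) * var_x ^ (n + 2)
      + of_int (c + int n + 2) * (var_x ^ n * var_y ^ 2)"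
    unfolding c'[symmetric] by (simp add: algebra_simps power_add eval_nat_numeral)
  have eq: "fold_X (Suc (Suc (Suc (Suc n)))) - ?M (Suc (Suc (Suc (Suc n)))) =
      var_x * (fold_X (Suc (Suc (Suc n))) - ?M (Suc (Suc (Suc n))))
      + var_x * (fold_X (Suc n) - var_x ^ Suc n)
      - 2 * (fold_X (Suc (Suc n)) - var_x ^ Suc (Suc n))
      - var_y * (fold_X (Suc (Suc n)) - (var_x ^ Suc (Suc n)
          - of_nat (Suc (Suc n)) * var_x ^ (Suc (Suc n) - 2) * var_y)) - fold_X n"
    \<comment> \<open>Only the product of x with the main part is distributed, so that
      \<open>M3\<close> applies to it as a whole.\<close>
    unfolding right_diff_distrib[of var_x _ "?M _"] M3 M4
    by (simp add: algebra_simps power2_eq_square power_add eval_nat_numeral)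
  show ?case
    unfolding eq
    by (intro total_degree_le_intros 5(1)[THEN total_degree_le_mono]
        fold_X_order_1[THEN total_degree_le_mono] fold_X_order_2[THEN total_degree_le_mono]
        fold_X_degree[THEN total_degree_le_mono]) simp_all
\<comment> \<open>At n = 3 the remainder is exactly 0: the coefficient n(n-3)/2 vanishes, and with
  it the term whose exponent n - 4 is truncated.\<close>
qed (simp_all add: total_degree_le_0 algebra_simps power3_eq_cube)

lemma fold_Y_degree: "fold_Y n \<in> total_degree_le (int n)"
proof (induction n rule: fold_Y.induct)
  case (5 n)
  show ?case
    unfolding fold_Y.simps left_diff_distrib mult.assoc
    by (intro total_degree_le_intros 5[THEN total_degree_le_mono]) simp_all
qed (simp_all add: mult.assoc power2_eq_square power3_eq_cube, (intro total_degree_le_intros; simp)+)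

lemma fold_Y_expansion:
  "n \<ge> 2 \<Longrightarrow> \<exists>A \<in> total_degree_le (int n - 3). \<exists>E \<in> total_degree_le (int n - 1).
    fold_Y n = var_y ^ n - of_nat n * var_x ^ 2 * var_y ^ (n - 2) + var_x ^ 3 * A + E"
proof (induction n rule: fold_Y.induct)
  case 3
  show ?case
  proof (intro bexI)
    \<comment> \<open>The bound on the cofactor of x^3 is -1 here, so 0 is the only choice.\<close>
    show "fold_Y (Suc (Suc 0)) = var_y ^ Suc (Suc 0)
        - of_nat (Suc (Suc 0)) * var_x ^ 2 * var_y ^ (Suc (Suc 0) - 2)
        + var_x ^ 3 * 0 + (4 * var_y + 4)"
      by (simp add: power2_eq_square)
  qed (intro total_degree_le_intros; simp)+
next
  case 4
  show ?case
  proof (intro bexI)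
    show "fold_Y (Suc (Suc (Suc 0))) = var_y ^ Suc (Suc (Suc 0))
        - of_nat (Suc (Suc (Suc 0))) * var_x ^ 2 * var_y ^ (Suc (Suc (Suc 0)) - 2)
        + var_x ^ 3 * 0 + (6 * var_y ^ 2 + 9 * var_y)"
      by (simp add: power3_eq_cube)
  qed (intro total_degree_le_intros; simp)+
next
  case (5 n)
  obtain A E where A: "A \<in> total_degree_le (int n)" and E: "E \<in> total_degree_le (2 + int n)"
    and Y3: "fold_Y (Suc (Suc (Suc n))) = var_y ^ Suc (Suc (Suc n))
      - of_nat (Suc (Suc (Suc n))) * var_x ^ 2 * var_y ^ (Suc (Suc (Suc n)) - 2) + var_x ^ 3 * A + E"
    using 5(1) by auto
  \<comment> \<open>The induction hypotheses follow the order of the recursive calls, so the third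
    one concerns n + 2.\<close>
  obtain B F where B: "B \<in> total_degree_le (int n - 1)" and F: "F \<in> total_degree_le (1 + int n)"
    and Y2: "fold_Y (Suc (Suc n)) = var_y ^ Suc (Suc n)
      - of_nat (Suc (Suc n)) * var_x ^ 2 * var_y ^ (Suc (Suc n) - 2) + var_x ^ 3 * B + F"
    using 5(3) by auto
  \<comment> \<open>The middle summand comes from -x^2 times -(n+2) x^2 y^n. The product (n+2) x^4
    y^n has degree n + 4, too high for \<open>E'\<close>, but it is a multiple of x^3.\<close>
  define A' where "A' = var_y * A + of_nat (n + 2) * (var_x * var_y ^ n) - var_x ^ 2 * B"
  \<comment> \<open>All summands have degree at most n + 3; for those that contain values of
    \<open>fold_Y\<close>, \<open>fold_Y_degree\<close> suffices.\<close>
  define E' where "E' = var_y * E + var_y * fold_Y (Suc n) - var_x ^ 2 * F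
    + 2 * (var_y * fold_Y (Suc (Suc n))) + 2 * fold_Y (Suc (Suc n)) - fold_Y n"
  \<comment> \<open>The low-degree values of \<open>fold_Y\<close> stay hidden in \<open>E'\<close>,
    so \<open>Y3\<close> and \<open>Y2\<close> expand only the two terms of top degree.\<close>
  have "fold_Y (Suc (Suc (Suc (Suc n)))) = var_y * fold_Y (Suc (Suc (Suc n)))
      - var_x ^ 2 * fold_Y (Suc (Suc n)) + (E' - var_y * E + var_x ^ 2 * F)"
    unfolding E'_def by (simp add: algebra_simps)
  also have "\<dots> = var_y ^ (n + 4) - of_nat (n + 4) * var_x ^ 2 * var_y ^ (n + 2)
      + var_x ^ 3 * A' + E'"
    unfolding Y3 Y2 A'_def by (simp add: algebra_simps power2_eq_square power3_eq_cube eval_nat_numeral)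
  finally have eq: "fold_Y (Suc (Suc (Suc (Suc n)))) = var_y ^ Suc (Suc (Suc (Suc n)))
      - of_nat (Suc (Suc (Suc (Suc n)))) * var_x ^ 2 * var_y ^ (Suc (Suc (Suc (Suc n))) - 2)
      + var_x ^ 3 * A' + E'"
    by (simp add: eval_nat_numeral)
  have "A' \<in> total_degree_le (int (Suc (Suc (Suc (Suc n)))) - 3)"
    unfolding A'_def
    by (intro total_degree_le_intros A[THEN total_degree_le_mono] B[THEN total_degree_le_mono])
      simp_all
  moreover have "E' \<in> total_degree_le (int (Suc (Suc (Suc (Suc n)))) - 1)"
    unfolding E'_def
    by (intro total_degree_le_intros E[THEN total_degree_le_mono] F[THEN total_degree_le_mono]
        fold_Y_degree[THEN total_degree_le_mono]) simp_all
  ultimately show ?case using eq by blast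
qed simp_all

text \<open>For n = 1 and n = 2 the coefficient n(n-3)/2 is -1 while the exponent n - 4 is negative,
  so the expansion of X is read from n = 3 on.\<close>

theorem proposition3p1:
  fixes n :: nat and X Y :: "int poly poly"
  assumes "folding_map_B2 n = (X, Y)"
  shows
    "(n \<ge> 3 \<longrightarrow>
       (\<exists>E \<in> total_degree_le (int n - 3).
          X = var_x ^ n - of_nat n * var_x ^ (n - 2) * var_y - of_nat n * var_x ^ (n - 2)
              + of_int (int n * (int n - 3) div 2) * var_x ^ (n - 4) * var_y ^ 2 + E))
     \<and> (n \<ge> 2 \<longrightarrow>
       (\<exists>A \<in> total_degree_le (int n - 3). \<exists>E \<in> total_degree_le (int n - 1).
          Y = var_y ^ n - of_nat n * var_x ^ 2 * var_y ^ (n - 2) + var_x ^ 3 * A + E))"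
proof -
  have X: "X = fold_X n" and Y: "Y = fold_Y n"
    using assms by (simp_all add: folding_map_B2_def)
  show ?thesis
    unfolding X Y
    by (intro conjI impI fold_Y_expansion bexI[OF _ fold_X_order_3]) simp_all
qed

end
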